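(* Let $C\subseteq\mathbb{R}^d$ be a proper polyhedral cone. (i) If $C$ is a simplex cone, then $C^{\rm pt}=C^{\rm ph}$, i.e. $C_s^{\rm pt}=C_s^{\rm ph}$ for all integers $s\geq 1$. (ii) If $C$ is not a simplex cone, then $C_2^{\rm pt}\subsetneq C_2^{\rm ph}$.
   Context: A convex cone $C\subseteq\mathbb{R}^d$ is polyhedral if there are linear functionals $\ell_1,\ldots,\ell_m\colon\mathbb{R}^d\to\mathbb{R}$ with $C=\{a\in\mathbb{R}^d\mid \ell_1(a)\geq 0,\ldots,\ell_m(a)\geq 0\}$. By the Minkowski-Weyl theorem, this is equivalent to $C$ being finitely generated, i.e. there are $v_1,\ldots,v_n\in\mathbb{R}^d$ with $C=\{\sum_{i=1}^n\lambda_i v_i\mid \lambda_1,\ldots,\lambda_n\geq 0\}$. A convex cone $C\subseteq\mathbb{R}^d$ is proper if it is closed, has nonempty interior, and satisfies $C\cap -C=\{0\}$. A proper cone $C\subseteq\mathbb{R}^d$ is a simplex cone if it is generated by $d$ linearly independent vectors (equivalently, it is the image of the positive orthant $\mathbb{R}_{\geq 0}^d$ under a linear isomorphism of $\mathbb{R}^d$). For an integer $s\geq 1$, let ${\rm Her}_s$ be the real vector space of complex Hermitian $s\times s$ matrices, and write $P\geqslant 0$ if $P\in{\rm Her}_s$ is positive semidefinite. A linear functional $\ell(x)=c_1x_1+\cdots+c_dx_d$ on $\mathbb{R}^d$ is evaluated at $(A_1,\ldots,A_d)\in{\rm Her}_s^d$ by $\ell(A_1,\ldots,A_d)=c_1A_1+\cdots+c_dA_d\in{\rm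 Her}_s$. For $P\in{\rm Her}_s$ and $v=(v^{(1)},\ldots,v^{(d)})\in\mathbb{R}^d$, write $P\otimes v:=(v^{(1)}P,\ldots,v^{(d)}P)\in{\rm Her}_s^d$. For a polyhedral cone $C=\{a\in\mathbb{R}^d\mid \ell_1(a)\geq 0,\ldots,\ell_m(a)\geq 0\}=\{\sum_{i=1}^n\lambda_i v_i\mid \lambda_1,\ldots,\lambda_n\geq 0\}$ with defining linear functionals $\ell_1,\ldots,\ell_m\colon\mathbb{R}^d\to\mathbb{R}$ and generators $v_1,\ldots,v_n\in\mathbb{R}^d$, define for each integer $s\geq 1$ $$C_s^{\rm ph}:=\{(A_1,\ldots,A_d)\in{\rm Her}_s^d\mid \ell_i(A_1,\ldots,A_d)\geqslant 0,\ i=1,\ldots,m\},$$ $$C_s^{\rm pt}:=\Big\{\sum_{i=1}^n P_i\otimes v_i\ \Big|\ P_i\in{\rm Her}_s,\ P_i\geqslant 0,\ i=1,\ldots,n\Big\},$$ and $C^{\rm ph}:=(C_s^{\rm ph})_{s\geq 1}$, $C^{\rm pt}:=(C_s^{\rm pt})_{s\geq 1}$. These sets depend only on $C$, not on the chosen functionals or generators. *)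

theory Defs
  imports "HOL-Analysis.Analysis"
begin

definition proper_cone :: "(real^'d) set \<Rightarrow> bool" where
  "proper_cone C \<longleftrightarrow>
     convex_cone C \<and> closed C \<and> interior C \<noteq> {} \<and> C \<inter> uminus ` C = {0}"

definition halfspace_cone :: "nat \<Rightarrow> (nat \<Rightarrow> real^'d \<Rightarrow> real) \<Rightarrow> (real^'d) set" where
  "halfspace_cone m l = {a. \<forall>i<m. 0 \<le> l i a}"

definition generated_cone :: "nat \<Rightarrow> (nat \<Rightarrow> real^'d) \<Rightarrow> (real^'d) set" where
  "generated_cone n v = {(\<Sum>i<n. c i *\<^sub>R v i) | c :: nat \<Rightarrow> real. \<forall>i<n. 0 \<le> c i}"

definition simplex_cone :: "(real^'d) set \<Rightarrow> bool" where
  "simplex_cone C \<longleftrightarrow>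
     proper_cone C \<and>
     (\<exists>w. inj_on w {..<CARD('d)} \<and> independent (w ` {..<CARD('d)}) \<and>
          C = generated_cone CARD('d) w)"

definition Her :: "(complex^'s^'s) set" where
  "Her = {A. \<forall>i j. A $ i $ j = cnj (A $ j $ i)}"

text \<open>The Hermitian form of a matrix in \<^term>\<open>Her\<close> takes real values, so
  taking the real part loses nothing.\<close>

definition psd :: "complex^'s^'s \<Rightarrow> bool" where
  "psd P \<longleftrightarrow> P \<in> Her \<and> (\<forall>x. 0 \<le> Re (\<Sum>i\<in>UNIV. cnj (x $ i) * (P *v x) $ i))"

text \<open>The coefficients of a linear functional are its values
  \<open>c\<^sub>j = f (axis j 1)\<close> on the standard basis.\<close>

definition eval_functional :: "(real^'d \<Rightarrow> real) \<Rightarrow> complex^'s^'s^'d \<Rightarrow> complex^'s^'s" where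
  "eval_functional f A = (\<Sum>j\<in>UNIV. f (axis j 1) *\<^sub>R (A $ j))"

definition mat_tensor :: "complex^'s^'s \<Rightarrow> real^'d \<Rightarrow> complex^'s^'s^'d" where
  "mat_tensor P v = (\<chi> j. (v $ j) *\<^sub>R P)"

text \<open>The matrix size \<open>s\<close> is \<open>CARD('s)\<close>. Both families of sets are given by the data
  representing the cone: functionals \<open>l 0, \<dots>, l (m - 1)\<close> and
  generators \<open>v 0, \<dots>, v (n - 1)\<close>.\<close>

definition C_ph :: "nat \<Rightarrow> (nat \<Rightarrow> real^'d \<Rightarrow> real) \<Rightarrow> (complex^'s^'s^'d) set" where
  "C_ph m l = {A. (\<forall>j. A $ j \<in> Her) \<and> (\<forall>i<m. psd (eval_functional (l i) A))}"

definition C_pt :: "nat \<Rightarrow> (nat \<Rightarrow> real^'d) \<Rightarrow> (complex^'s^'s^'d) set" where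
  "C_pt n v = {(\<Sum>i<n. mat_tensor (P i) (v i)) | P. \<forall>i<n. psd (P i)}"

end

theory Submission
  imports Defs
begin

text \<open>
  The inclusion \<open>C_pt \<subseteq> C_ph\<close> holds because the \<open>l i\<close> are nonnegative on the generators.
  For the rest, a tuple \<open>A\<close> of Hermitian matrices is read as a Hermitian form with values in
  \<open>\<real>\<^sup>d\<close>, sending \<open>x\<close> to the vector with entries \<open>x\<^sup>* A\<^sub>j x\<close>; membership in \<open>C_ph\<close> says that
  all its values lie in \<open>C\<close>.

  If \<open>C\<close> is generated by a basis \<open>w\<close> with dual basis \<open>f\<close>, then \<open>A\<close> is the sum of the tensors
  \<open>f\<^sub>k(A) \<otimes> w\<^sub>k\<close>, and \<open>f\<^sub>k(A)\<close> is positive semidefinite because \<open>f\<^sub>k\<close> is nonnegative on the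
  values of the form. This is \<open>C_ph_subset_C_pt_if_simplex_cone\<close>.

  Conversely let \<open>C_ph \<subseteq> C_pt\<close> for 2 by 2 matrices. The heart of the proof is
  \<open>span_face_Int\<close>: if two faces \<open>F\<close> and \<open>G\<close> of \<open>C\<close> each span the common kernel of the
  functionals that cut them out, then \<open>F \<inter> G\<close> spans the whole intersection of the two kernels.
  Take \<open>b\<close> in that intersection, and \<open>a\<close> and \<open>c\<close> in the relative
  interiors of \<open>F\<close> and \<open>G\<close>. The block matrix with diagonal \<open>N a\<close>, \<open>N c\<close> and off-diagonal
  entry \<open>b\<close> belongs to \<open>C_ph\<close> for large \<open>N\<close>: each \<open>l i\<close> that vanishes at \<open>a\<close> or \<open>c\<close> also
  vanishes at \<open>b\<close>. Write the block matrix as a sum of tensors \<open>P\<^sub>k \<otimes> v\<^sub>k\<close>. A term that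
  contributes to \<open>b\<close> has a nonzero off-diagonal entry, hence two nonzero diagonal entries, so it
  contributes to \<open>a \<in> F\<close> and to \<open>c \<in> G\<close>, and its \<open>v\<^sub>k\<close> lies in \<open>F \<inter> G\<close>. Thus \<open>b\<close> is a
  combination of vectors of \<open>F \<inter> G\<close>. (For the cone over a square this fails: the planes of two
  opposite facets meet in a line, the facets only in the apex.)

  The facets of \<open>C\<close> span their hyperplanes, so by induction every intersection of facets spans
  the corresponding intersection of hyperplanes. Select facet functionals that form a basis of the
  dual space. For each of them, the intersection of the other hyperplanes is a line, which is now
  spanned by a vector of \<open>C\<close>. Scaled suitably, these vectors form the dual basis. It generates
  \<open>C\<close>, since the coordinates of a vector of \<open>C\<close> are values of functionals \<open>l i\<close>.
\<close>

section \<open>Hermitian forms and positive semidefinite matrices\<close>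

definition herm_form :: "complex^'s \<Rightarrow> complex^'s^'s \<Rightarrow> real" where
  "herm_form x P = Re (\<Sum>i\<in>UNIV. cnj (x $ i) * (P *v x) $ i)"

lemma psd_iff_herm_form: "psd P \<longleftrightarrow> P \<in> Her \<and> (\<forall>x. 0 \<le> herm_form x P)"
  by (simp add: psd_def herm_form_def)

lemma linear_herm_form: "linear (herm_form x)"
proof (rule linearI)
  show "herm_form x (P + Q) = herm_form x P + herm_form x Q" for P Q
    by (simp add: herm_form_def matrix_vector_mult_add_rdistrib distrib_left sum.distrib)
  show "herm_form x (r *\<^sub>R P) = r *\<^sub>R herm_form x P" for r P
    by (simp add: herm_form_def matrix_vector_mult_def sum_distrib_left algebra_simps)
qed

text \<open>As a rewrite rule, the equation that defines \<^term>\<open>Her\<close> can be applied to its own right-hand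
  side. These two rules orient it.\<close>
lemma HerI: "(\<And>i j. A $ i $ j = cnj (A $ j $ i)) \<Longrightarrow> A \<in> Her"
  unfolding Her_def by (intro CollectI allI)

lemma HerD: "A \<in> Her \<Longrightarrow> cnj (A $ j $ i) = A $ i $ j"
  unfolding Her_def by (rule sym, drule CollectD, erule allE, erule allE)

lemma Her_zero: "0 \<in> Her"
  and Her_add: "P \<in> Her \<Longrightarrow> Q \<in> Her \<Longrightarrow> P + Q \<in> Her"
  and Her_scaleR: "P \<in> Her \<Longrightarrow> r *\<^sub>R P \<in> Her"
  by (rule HerI; simp add: HerD)+

lemma Her_sum: "(\<And>i. i \<in> I \<Longrightarrow> P i \<in> Her) \<Longrightarrow> (\<Sum>i\<in>I. P i) \<in> Her"
  by (induction I rule: infinite_finite_induct) (auto intro: Her_zero Her_add)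

lemma psd_sum_scaleR:
  assumes "\<And>i. i \<in> I \<Longrightarrow> psd (P i)" "\<And>i. i \<in> I \<Longrightarrow> 0 \<le> c i"
  shows "psd (\<Sum>i\<in>I. c i *\<^sub>R P i)"
  using assms
  by (auto simp: psd_iff_herm_form linear_sum[OF linear_herm_form] linear_cmul[OF linear_herm_form]
      intro!: Her_sum Her_scaleR sum_nonneg)

section \<open>Applying linear functionals to tuples of matrices\<close>

lemma linear_functional_expand:
  fixes f :: "real^'d \<Rightarrow> real"
  assumes "linear f"
  shows "f y = (\<Sum>j\<in>UNIV. f (axis j 1) * y $ j)"
proof -
  have "f y = f (\<Sum>j\<in>UNIV. y $ j *\<^sub>R axis j 1)"
    using basis_expansion[of y] by (simp add: scalar_mult_eq_scaleR)
  then show ?thesis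
    by (simp add: linear_sum[OF assms] linear_cmul[OF assms] mult.commute)
qed

text \<open>Taking the form at \<open>x\<close> and applying \<open>f\<close> commute. So positivity of the matrices
  \<open>f(A)\<close> is a statement about the values of \<open>f\<close> at the vectors with entries
  \<open>x\<^sup>* A\<^sub>j x\<close>.\<close>
lemma herm_form_eval_functional:
  fixes f :: "real^'d \<Rightarrow> real"
  assumes "linear f"
  shows "herm_form x (eval_functional f A) = f (\<chi> j. herm_form x (A $ j))"
  by (subst linear_functional_expand[OF assms])
    (simp add: eval_functional_def linear_sum[OF linear_herm_form]
      linear_cmul[OF linear_herm_form])

lemma eval_functional_mat_tensor_sum:
  fixes f :: "real^'d \<Rightarrow> real"
  assumes "linear f"
  shows "eval_functional f (\<Sum>i\<in>I. mat_tensor (P i) (v i)) = (\<Sum>i\<in>I. f (v i) *\<^sub>R P i)"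
proof -
  have "eval_functional f (\<Sum>i\<in>I. mat_tensor (P i) (v i))
      = (\<Sum>j\<in>UNIV. \<Sum>i\<in>I. (f (axis j 1) * v i $ j) *\<^sub>R P i)"
    by (simp add: eval_functional_def mat_tensor_def scaleR_sum_right)
  also have "\<dots> = (\<Sum>i\<in>I. (\<Sum>j\<in>UNIV. f (axis j 1) * v i $ j) *\<^sub>R P i)"
    by (subst sum.swap) (simp add: scaleR_sum_left)
  finally show ?thesis
    by (simp add: linear_functional_expand[OF assms, symmetric])
qed

lemma generator_in_generated_cone:
  assumes "i < n"
  shows "v i \<in> generated_cone n v"
proof -
  have "v i = (\<Sum>k<n. (if k = i then 1 else 0) *\<^sub>R v k)"
    using assms by (simp add: if_distrib[of "\<lambda>c. c *\<^sub>R _"] cong: if_cong)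
  then show ?thesis
    unfolding generated_cone_def by (intro CollectI exI[of _ "\<lambda>k. if k = i then 1 else 0"]) simp
qed

lemma C_pt_subset_C_ph:
  fixes l :: "nat \<Rightarrow> real^'d \<Rightarrow> real"
  assumes lin: "\<And>i. i < m \<Longrightarrow> linear (l i)"
    and C: "halfspace_cone m l = generated_cone n v"
  shows "C_pt n v \<subseteq> C_ph m l"
proof
  fix A :: "complex^'s^'s^'d"
  assume "A \<in> C_pt n v"
  then obtain P :: "nat \<Rightarrow> complex^'s^'s"
    where A: "A = (\<Sum>i<n. mat_tensor (P i) (v i))" and P: "\<And>i. i < n \<Longrightarrow> psd (P i)"
    unfolding C_pt_def by blast
  have "A $ j \<in> Her" for j
    unfolding A using P by (auto simp: mat_tensor_def psd_def intro!: Her_sum Her_scaleR)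
  moreover have "psd (eval_functional (l i) A)" if "i < m" for i
  proof -
    have "0 \<le> l i (v k)" if "k < n" for k
      using generator_in_generated_cone[OF that, of v] C \<open>i < m\<close>
      by (auto simp: halfspace_cone_def)
    then show ?thesis
      unfolding A eval_functional_mat_tensor_sum[OF lin[OF that]]
      by (intro psd_sum_scaleR P) auto
  qed
  ultimately show "A \<in> C_ph m l"
    by (simp add: C_ph_def)
qed

section \<open>Simplex cones\<close>

lemma dual_basis:
  fixes w :: "nat \<Rightarrow> real^'d"
  assumes inj: "inj_on w {..<CARD('d)}" and ind: "independent (w ` {..<CARD('d)})"
  obtains f :: "nat \<Rightarrow> real^'d \<Rightarrow> real"
  where "\<And>k. linear (f k)"
    and "\<And>k c. k < CARD('d) \<Longrightarrow> f k (\<Sum>j<CARD('d). c j *\<^sub>R w j) = c k"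
    and "\<And>y. y = (\<Sum>k<CARD('d). f k y *\<^sub>R w k)"
proof -
  have "\<exists>f. linear f \<and> (\<forall>x\<in>w ` {..<CARD('d)}. f x = (if x = w k then 1 else 0::real))" for k
    using linear_independent_extend[OF ind, of "\<lambda>x. if x = w k then 1 else 0"] by metis
  then obtain f :: "nat \<Rightarrow> real^'d \<Rightarrow> real" where f: "\<And>k. linear (f k)"
    "\<And>k x. x \<in> w ` {..<CARD('d)} \<Longrightarrow> f k x = (if x = w k then 1 else 0)"
    by metis
  have coord: "f k (\<Sum>j<CARD('d). c j *\<^sub>R w j) = c k" if "k < CARD('d)" for k c
  proof -
    have "f k (\<Sum>j<CARD('d). c j *\<^sub>R w j) = (\<Sum>j<CARD('d). c j * f k (w j))"
      by (simp add: linear_sum[OF f(1)] linear_cmul[OF f(1)])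
    also have "\<dots> = (\<Sum>j<CARD('d). if j = k then c j else 0)"
      using that inj by (intro sum.cong) (auto simp: f(2) inj_on_def)
    finally show ?thesis
      using that by simp
  qed
  have "span (w ` {..<CARD('d)}) = UNIV"
    using card_ge_dim_independent[OF subset_UNIV ind] inj by (auto simp: card_image)
  moreover have "y = (\<Sum>k<CARD('d). f k y *\<^sub>R w k)" if y: "y \<in> span (w ` {..<CARD('d)})" for y
  proof -
    obtain d where "y = (\<Sum>x\<in>w ` {..<CARD('d)}. d x *\<^sub>R x)"
      using y unfolding span_finite[OF finite_imageI[OF finite_lessThan]] by blast
    then have "y = (\<Sum>k<CARD('d). d (w k) *\<^sub>R w k)"
      by (simp add: sum.reindex[OF inj])
    with coord[of _ "\<lambda>k. d (w k)"] show ?thesis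
      by simp
  qed
  ultimately show thesis
    by (intro that[of f] f(1) coord) auto
qed

text \<open>The coefficient matrices with respect to the basis \<open>w\<close> are the \<open>f\<^sub>k(A)\<close>, where \<open>f\<close> is the
  dual basis. Since the representation is wanted in terms of the given generators \<open>v\<close>, each
  \<open>w\<^sub>k\<close> is finally expanded as a nonnegative combination of them.\<close>
lemma C_ph_subset_C_pt_if_simplex_cone:
  fixes l :: "nat \<Rightarrow> real^'d \<Rightarrow> real"
  assumes lin: "\<And>i. i < m \<Longrightarrow> linear (l i)"
    and hs: "C = halfspace_cone m l"
    and gen: "C = generated_cone n v"
    and "simplex_cone C"
  shows "C_ph m l \<subseteq> C_pt n v"
proof
  fix A :: "complex^'s^'s^'d"
  assume A: "A \<in> C_ph m l"
  obtain w :: "nat \<Rightarrow> real^'d" where w: "inj_on w {..<CARD('d)}" "independent (w ` {..<CARD('d)})"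
    "C = generated_cone CARD('d) w"
    using \<open>simplex_cone C\<close> unfolding simplex_cone_def by blast
  obtain f :: "nat \<Rightarrow> real^'d \<Rightarrow> real" where f: "\<And>k. linear (f k)"
    "\<And>k c. k < CARD('d) \<Longrightarrow> f k (\<Sum>j<CARD('d). c j *\<^sub>R w j) = c k"
    "\<And>y. y = (\<Sum>k<CARD('d). f k y *\<^sub>R w k)"
    using dual_basis[OF w(1,2)] by blast
  define Q where "Q k = eval_functional (f k) A" for k
  have Q_psd: "psd (Q k)" if "k < CARD('d)" for k
    unfolding psd_iff_herm_form
  proof (intro conjI allI)
    show "Q k \<in> Her"
      using A by (auto simp: Q_def eval_functional_def C_ph_def intro!: Her_sum Her_scaleR)
    fix x
    \<comment> \<open>All values of the vector-valued form lie in \<open>C\<close>, where the coordinates \<open>f k\<close> are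
      nonnegative.\<close>
    have "(\<chi> j. herm_form x (A $ j)) \<in> C"
      using A by (auto simp: hs halfspace_cone_def C_ph_def psd_iff_herm_form
          herm_form_eval_functional[OF lin, symmetric])
    then obtain c where "(\<chi> j. herm_form x (A $ j)) = (\<Sum>j<CARD('d). c j *\<^sub>R w j)"
      and "\<forall>i<CARD('d). 0 \<le> c i"
      unfolding w(3) generated_cone_def by blast
    then show "0 \<le> herm_form x (Q k)"
      using that by (simp add: Q_def herm_form_eval_functional[OF f(1)] f(2))
  qed
  have expand: "A = (\<Sum>k<CARD('d). mat_tensor (Q k) (w k))"
  proof (subst vec_eq_iff, rule allI)
    fix j
    have "(\<Sum>k<CARD('d). mat_tensor (Q k) (w k)) $ j
        = (\<Sum>k<CARD('d). \<Sum>i\<in>UNIV. (f k (axis i 1) * w k $ j) *\<^sub>R A $ i)"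
      by (simp add: mat_tensor_def Q_def eval_functional_def scaleR_sum_right mult.commute)
    also have "\<dots> = (\<Sum>i\<in>UNIV. (\<Sum>k<CARD('d). f k (axis i 1) *\<^sub>R w k) $ j *\<^sub>R A $ i)"
      by (subst sum.swap) (simp add: scaleR_sum_left)
    also have "\<dots> = (\<Sum>i\<in>UNIV. (axis i 1 :: real^'d) $ j *\<^sub>R A $ i)"
      by (simp only: f(3)[symmetric])
    also have "\<dots> = A $ j"
      by (simp add: axis_def if_distrib[of "\<lambda>c. c *\<^sub>R _"] cong: if_cong)
    finally show "A $ j = (\<Sum>k<CARD('d). mat_tensor (Q k) (w k)) $ j" ..
  qed
  have "\<exists>c. w k = (\<Sum>i<n. c i *\<^sub>R v i) \<and> (\<forall>i<n. 0 \<le> c i)" if "k < CARD('d)" for k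
    using generator_in_generated_cone[OF that, of w] w(3) gen by (auto simp: generated_cone_def)
  then obtain c :: "nat \<Rightarrow> nat \<Rightarrow> real"
    where c: "\<And>k. k < CARD('d) \<Longrightarrow> w k = (\<Sum>i<n. c k i *\<^sub>R v i)"
      "\<And>k i. k < CARD('d) \<Longrightarrow> i < n \<Longrightarrow> 0 \<le> c k i"
    by metis
  have "A = (\<Sum>i<n. mat_tensor (\<Sum>k<CARD('d). c k i *\<^sub>R Q k) (v i))"
  proof (subst vec_eq_iff, rule allI)
    fix j
    have "A $ j = (\<Sum>k<CARD('d). (\<Sum>i<n. c k i *\<^sub>R v i) $ j *\<^sub>R Q k)"
      by (subst expand) (simp add: mat_tensor_def c(1))
    also have "\<dots> = (\<Sum>i<n. \<Sum>k<CARD('d). (c k i * v i $ j) *\<^sub>R Q k)"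
      by (subst sum.swap) (simp add: scaleR_sum_left)
    finally show "A $ j = (\<Sum>i<n. mat_tensor (\<Sum>k<CARD('d). c k i *\<^sub>R Q k) (v i)) $ j"
      by (simp add: mat_tensor_def scaleR_sum_right mult.commute)
  qed
  moreover have "psd (\<Sum>k<CARD('d). c k i *\<^sub>R Q k)" if "i < n" for i
    using that by (intro psd_sum_scaleR Q_psd c(2)) auto
  ultimately show "A \<in> C_pt n v"
    unfolding C_pt_def by (intro CollectI exI[of _ "\<lambda>i. \<Sum>k<CARD('d). c k i *\<^sub>R Q k"]) auto
qed

section \<open>Positive semidefinite matrices of size two\<close>

definition sym2 :: "real \<Rightarrow> real \<Rightarrow> real \<Rightarrow> complex^2^2" where
  "sym2 a b c = (\<chi> i j. complex_of_real (if i = j then if i = 1 then a else c else b))"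

lemma herm_form_2:
  fixes P :: "complex^2^2"
  shows "herm_form x P = Re (cnj (x$1) * (P$1$1 * x$1 + P$1$2 * x$2)
    + cnj (x$2) * (P$2$1 * x$1 + P$2$2 * x$2))"
  by (simp add: herm_form_def matrix_vector_mult_def sum_2)

lemma psd_sym2:
  assumes "0 \<le> a" "0 \<le> c" "b\<^sup>2 \<le> a * c"
  shows "psd (sym2 a b c)"
  unfolding psd_iff_herm_form
proof (intro conjI allI)
  show "sym2 a b c \<in> Her"
    by (rule HerI) (simp add: sym2_def)
  have real: "0 \<le> a * p\<^sup>2 + 2 * b * p * q + c * q\<^sup>2" for p q
  proof (cases "a = 0")
    case True
    then have "b = 0"
      using assms by simp
    with True assms show ?thesis by simp
  next
    case False
    \<comment> \<open>Complete the square.\<close>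
    have "a * (a * p\<^sup>2 + 2 * b * p * q + c * q\<^sup>2) = (a * p + b * q)\<^sup>2 + (a * c - b\<^sup>2) * q\<^sup>2"
      by (simp add: power2_eq_square algebra_simps)
    moreover have "\<dots> \<ge> 0"
      using assms by simp
    ultimately show ?thesis
      using False assms by (metis less_eq_real_def mult_pos_neg not_le)
  qed
  fix x :: "complex^2"
  have "herm_form x (sym2 a b c)
    = (a * (Re (x$1))\<^sup>2 + 2 * b * Re (x$1) * Re (x$2) + c * (Re (x$2))\<^sup>2)
    + (a * (Im (x$1))\<^sup>2 + 2 * b * Im (x$1) * Im (x$2) + c * (Im (x$2))\<^sup>2)"
    by (simp add: herm_form_2 sym2_def power2_eq_square algebra_simps)
  then show "0 \<le> herm_form x (sym2 a b c)"
    using real by simp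
qed

lemma psd_diag_nonneg:
  fixes P :: "complex^2^2"
  assumes "psd P"
  shows "0 \<le> Re (P$1$1)" "0 \<le> Re (P$2$2)"
proof -
  have *: "0 \<le> herm_form x P" for x
    using assms by (simp add: psd_iff_herm_form)
  show "0 \<le> Re (P$1$1)" "0 \<le> Re (P$2$2)"
    using *[of "axis 1 1"] *[of "axis 2 1"] by (simp_all add: herm_form_2 axis_def)
qed

text \<open>If a diagonal entry is zero, the form is affine in the corresponding real coordinate, with
  slope proportional to the off-diagonal entry; it can stay nonnegative only if the slope is zero.
  The vectors in the proof make the form equal to -1.\<close>
lemma psd_off_diag_eq_0:
  fixes P :: "complex^2^2"
  assumes "psd P" and "Re (P$1$1) = 0 \<or> Re (P$2$2) = 0"
  shows "Re (P$1$2) = 0"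
proof -
  have "P$2$1 = cnj (P$1$2)"
    using assms(1) HerD[of P 1 2] by (simp add: psd_def)
  then have form: "herm_form (\<chi> i. complex_of_real (if i = 1 then s else t)) P
      = s\<^sup>2 * Re (P$1$1) + 2 * s * t * Re (P$1$2) + t\<^sup>2 * Re (P$2$2)" for s t
    by (simp add: herm_form_2 power2_eq_square algebra_simps)
  have nonneg: "0 \<le> s\<^sup>2 * Re (P$1$1) + 2 * s * t * Re (P$1$2) + t\<^sup>2 * Re (P$2$2)" for s t
    using assms(1) by (simp add: psd_iff_herm_form form[symmetric])
  show ?thesis
  proof (rule ccontr)
    assume p: "Re (P$1$2) \<noteq> 0"
    from assms(2) show False
    proof
      assume "Re (P$1$1) = 0"
      then show False
        using nonneg[of "- (Re (P$2$2) + 1) / (2 * Re (P$1$2))" 1] p by (simp add: field_simps)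
    next
      assume "Re (P$2$2) = 0"
      then show False
        using nonneg[of 1 "- (Re (P$1$1) + 1) / (2 * Re (P$1$2))"] p by (simp add: field_simps)
    qed
  qed
qed

lemma eval_functional_sym2:
  fixes f :: "real^'d \<Rightarrow> real"
  assumes "linear f"
  shows "eval_functional f (\<chi> j. sym2 (a $ j) (b $ j) (c $ j)) = sym2 (f a) (f b) (f c)"
proof -
  have "eval_functional f (\<chi> j. sym2 (a $ j) (b $ j) (c $ j)) $ p $ q = sym2 (f a) (f b) (f c) $ p $ q"
    for p q
    unfolding linear_functional_expand[OF assms, of a] linear_functional_expand[OF assms, of b]
      linear_functional_expand[OF assms, of c]
    by (simp add: eval_functional_def sym2_def) (simp add: scaleR_conv_of_real)
  then show ?thesis
    by (simp add: vec_eq_iff)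
qed

section \<open>Faces cut out by defining functionals\<close>

definition common_kernel :: "(nat \<Rightarrow> real^'d \<Rightarrow> real) \<Rightarrow> nat set \<Rightarrow> (real^'d) set" where
  "common_kernel l S = {x. \<forall>i\<in>S. l i x = 0}"

text \<open>Used twice to turn a condition on zeros into an inequality: for the discriminants of the
  block matrices in \<open>span_face_Int\<close>, and to move slightly inside a facet in
  \<open>facet_functionals\<close>.\<close>
lemma dominating_multiplier:
  fixes a b :: "'i \<Rightarrow> real"
  assumes "finite I" "\<And>i. i \<in> I \<Longrightarrow> 0 \<le> a i" "\<And>i. i \<in> I \<Longrightarrow> a i = 0 \<Longrightarrow> b i = 0"
  obtains N where "1 \<le> N" "\<And>i. i \<in> I \<Longrightarrow> \<bar>b i\<bar> \<le> N * a i"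
proof
  let ?N = "1 + (\<Sum>i\<in>I. \<bar>b i\<bar> / a i)"
  show "1 \<le> ?N"
    using assms(2) by (simp add: sum_nonneg)
  fix i assume i: "i \<in> I"
  show "\<bar>b i\<bar> \<le> ?N * a i"
  proof (cases "a i = 0")
    case True
    with i assms(3) show ?thesis by simp
  next
    case False
    have "\<bar>b i\<bar> / a i \<le> (\<Sum>i\<in>I. \<bar>b i\<bar> / a i)"
      using assms i by (intro member_le_sum) auto
    then have "\<bar>b i\<bar> / a i \<le> ?N" by simp
    moreover have "0 < a i"
      using False assms(2)[OF i] by simp
    ultimately show ?thesis
      by (simp only: pos_divide_le_eq)
  qed
qed

text \<open>For every functional that is not identically zero on the face, choose a point of the face at
  which it is positive, and add up these points. Since all functionals are nonnegative on the
  face, nothing cancels.\<close>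
lemma relative_interior_point_of_face:
  fixes l :: "nat \<Rightarrow> real^'d \<Rightarrow> real"
  assumes lin: "\<And>i. i < m \<Longrightarrow> linear (l i)" and S: "S \<subseteq> {..<m}"
  obtains a where "a \<in> halfspace_cone m l \<inter> common_kernel l S"
    and "\<And>i x. i < m \<Longrightarrow> l i a = 0 \<Longrightarrow> x \<in> halfspace_cone m l \<inter> common_kernel l S \<Longrightarrow> l i x = 0"
proof -
  let ?F = "halfspace_cone m l \<inter> common_kernel l S"
  have zero: "0 \<in> ?F"
    using lin S by (auto simp: halfspace_cone_def common_kernel_def linear_0 subset_eq)
  have "\<exists>y\<in>?F. l i y = 0 \<longrightarrow> (\<forall>x\<in>?F. l i x = 0)" for i
    using zero by blast
  then obtain y where y: "\<And>i. y i \<in> ?F" "\<And>i x. l i (y i) = 0 \<Longrightarrow> x \<in> ?F \<Longrightarrow> l i x = 0"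
    by metis
  define a where "a = (\<Sum>k<m. y k)"
  have l_a: "l i a = (\<Sum>k<m. l i (y k))" if "i < m" for i
    unfolding a_def by (rule linear_sum[OF lin[OF that]])
  have nonneg: "0 \<le> l i (y k)" if "i < m" for i k
    using y(1)[of k] that by (simp add: halfspace_cone_def)
  show thesis
  proof
    show "a \<in> ?F"
      using y(1) S by (auto simp: halfspace_cone_def common_kernel_def subset_eq l_a
          intro!: sum_nonneg sum.neutral)
    fix i x
    assume i: "i < m" "l i a = 0" and x: "x \<in> ?F"
    then have "l i (y i) = 0"
      using nonneg by (simp add: l_a sum_nonneg_eq_0_iff)
    then show "l i x = 0"
      using y(2) x by blast
  qed
qed

text \<open>The obstruction to equality: a vector \<open>b\<close> in the spans of both faces but outside the span of
  their intersection yields an element of \<open>C_ph\<close> that is not in \<open>C_pt\<close>. Reading off the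
  off-diagonal entries of a decomposition of that element writes \<open>b\<close> in terms of
  generators that lie in both faces.\<close>
lemma span_face_Int:
  fixes l :: "nat \<Rightarrow> real^'d \<Rightarrow> real"
  assumes lin: "\<And>i. i < m \<Longrightarrow> linear (l i)"
    and hs: "C = halfspace_cone m l"
    and gen: "C = generated_cone n v"
    and eq: "(C_ph m l :: (complex^2^2^'d) set) \<subseteq> C_pt n v"
    and S: "S \<subseteq> {..<m}" "common_kernel l S \<subseteq> span (C \<inter> common_kernel l S)"
    and T: "T \<subseteq> {..<m}" "common_kernel l T \<subseteq> span (C \<inter> common_kernel l T)"
  shows "common_kernel l (S \<union> T) \<subseteq> span (C \<inter> common_kernel l (S \<union> T))"
proof
  fix b
  assume "b \<in> common_kernel l (S \<union> T)"
  then have b: "b \<in> common_kernel l S" "b \<in> common_kernel l T"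
    by (auto simp: common_kernel_def)
  obtain a where a: "a \<in> C \<inter> common_kernel l S"
    "\<And>i x. i < m \<Longrightarrow> l i a = 0 \<Longrightarrow> x \<in> C \<inter> common_kernel l S \<Longrightarrow> l i x = 0"
    using relative_interior_point_of_face[where l = l and m = m, OF lin S(1)] unfolding hs[symmetric] by blast
  obtain c where c: "c \<in> C \<inter> common_kernel l T"
    "\<And>i x. i < m \<Longrightarrow> l i c = 0 \<Longrightarrow> x \<in> C \<inter> common_kernel l T \<Longrightarrow> l i x = 0"
    using relative_interior_point_of_face[where l = l and m = m, OF lin T(1)] unfolding hs[symmetric] by blast
  have nonneg: "0 \<le> l i a" "0 \<le> l i c" if "i < m" for i
    using a(1) c(1) that by (auto simp: hs halfspace_cone_def)
  have vanish: "l i b = 0" if i: "i < m" "l i a * l i c = 0" for i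
  proof -
    have "l i b = 0" if "b \<in> span X" "\<And>x. x \<in> X \<Longrightarrow> l i x = 0" for X
      using linear_eq_0_on_span[OF lin[OF i(1)], of X b] that by blast
    then show ?thesis
      using i a(2) c(2) b S(2) T(2) by (metis mult_eq_0_iff subsetD)
  qed
  obtain N where N: "1 \<le> N" "\<And>i. i < m \<Longrightarrow> \<bar>(l i b)\<^sup>2\<bar> \<le> N * (l i a * l i c)"
    using dominating_multiplier[of "{..<m}" "\<lambda>i. l i a * l i c" "\<lambda>i. (l i b)\<^sup>2"] nonneg vanish
    by auto
  define A :: "complex^2^2^'d" where
    "A = (\<chi> j. sym2 ((N *\<^sub>R a) $ j) (b $ j) ((N *\<^sub>R c) $ j))"
  have "A \<in> C_ph m l"
    unfolding C_ph_def
  proof (intro CollectI conjI allI impI)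
    show "A $ j \<in> Her" for j
      by (rule HerI) (simp add: A_def sym2_def)
    fix i assume i: "i < m"
    \<comment> \<open>The discriminant condition is quadratic in the multiplier, and \<open>N \<le> N * N\<close> as
      \<open>1 \<le> N\<close>.\<close>
    have "N * (l i a * l i c) \<le> N * N * (l i a * l i c)"
      using N(1) nonneg[OF i] by (intro mult_right_mono) auto
    then have "(l i b)\<^sup>2 \<le> (N * l i a) * (N * l i c)"
      using N(2)[OF i] by (simp add: algebra_simps)
    then have "psd (sym2 (N * l i a) (l i b) (N * l i c))"
      using N(1) nonneg[OF i] by (intro psd_sym2) auto
    moreover have "eval_functional (l i) A = sym2 (N * l i a) (l i b) (N * l i c)"
      unfolding A_def eval_functional_sym2[OF lin[OF i]] by (simp add: linear_cmul[OF lin[OF i]])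
    ultimately show "psd (eval_functional (l i) A)"
      by simp
  qed
  with eq obtain P :: "nat \<Rightarrow> complex^2^2"
    where A: "A = (\<Sum>k<n. mat_tensor (P k) (v k))" and P: "\<And>k. k < n \<Longrightarrow> psd (P k)"
    unfolding C_pt_def by blast
  have v_in_C: "v k \<in> C" if "k < n" for k
    unfolding gen by (rule generator_in_generated_cone[OF that])
  have eval_A: "sym2 (N * l i a) (l i b) (N * l i c) = (\<Sum>k<n. l i (v k) *\<^sub>R P k)" if "i < m" for i
    using eval_functional_mat_tensor_sum[OF lin[OF that], of P v "{..<n}"]
      eval_functional_sym2[OF lin[OF that], of "N *\<^sub>R a" b "N *\<^sub>R c"]
    by (simp add: A[symmetric] linear_cmul[OF lin[OF that]]) (simp add: A_def)
  \<comment> \<open>On \<open>S\<close> the upper left entry of the block matrix vanishes, on \<open>T\<close> the lower right one. As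
    these are sums of nonnegative terms, each term vanishes.\<close>
  have in_kernel: "v k \<in> common_kernel l (S \<union> T)" if k: "k < n" and off: "Re (P k $ 1 $ 2) \<noteq> 0" for k
    unfolding common_kernel_def
  proof (intro CollectI ballI)
    fix i assume i: "i \<in> S \<union> T"
    then have "i < m" using S(1) T(1) by auto
    have v_nonneg: "0 \<le> l i (v k)" if "k < n" for k
      using v_in_C[OF that] \<open>i < m\<close> by (simp add: hs halfspace_cone_def)
    have diag: "Re (P k $ 1 $ 1) \<noteq> 0" "Re (P k $ 2 $ 2) \<noteq> 0"
      using psd_off_diag_eq_0[OF P[OF k]] off by auto
    from i show "l i (v k) = 0"
    proof
      assume "i \<in> S"
      then have "l i a = 0" using a(1) by (simp add: common_kernel_def)
      have "(\<Sum>k<n. l i (v k) * Re (P k $ 1 $ 1)) = Re (sym2 (N * l i a) (l i b) (N * l i c) $ 1 $ 1)"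
        by (simp add: eval_A[OF \<open>i < m\<close>])
      then have "(\<Sum>k<n. l i (v k) * Re (P k $ 1 $ 1)) = 0"
        using \<open>l i a = 0\<close> by (simp add: sym2_def)
      then have "l i (v k) * Re (P k $ 1 $ 1) = 0"
        using k v_nonneg psd_diag_nonneg(1)[OF P] by (subst (asm) sum_nonneg_eq_0_iff) auto
      then show ?thesis using diag by simp
    next
      assume "i \<in> T"
      then have "l i c = 0" using c(1) by (simp add: common_kernel_def)
      have "(\<Sum>k<n. l i (v k) * Re (P k $ 2 $ 2)) = Re (sym2 (N * l i a) (l i b) (N * l i c) $ 2 $ 2)"
        by (simp add: eval_A[OF \<open>i < m\<close>])
      then have "(\<Sum>k<n. l i (v k) * Re (P k $ 2 $ 2)) = 0"
        using \<open>l i c = 0\<close> by (simp add: sym2_def)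
      then have "l i (v k) * Re (P k $ 2 $ 2) = 0"
        using k v_nonneg psd_diag_nonneg(2)[OF P] by (subst (asm) sum_nonneg_eq_0_iff) auto
      then show ?thesis using diag by simp
    qed
  qed
  have "b = (\<Sum>k<n. Re (P k $ 1 $ 2) *\<^sub>R v k)"
  proof (subst vec_eq_iff, rule allI)
    fix j
    have "b $ j = Re (A $ j $ 1 $ 2)"
      by (simp add: A_def sym2_def)
    also have "\<dots> = (\<Sum>k<n. Re (P k $ 1 $ 2) *\<^sub>R v k) $ j"
      by (simp add: A mat_tensor_def mult.commute)
    finally show "b $ j = (\<Sum>k<n. Re (P k $ 1 $ 2) *\<^sub>R v k) $ j" .
  qed
  moreover have "Re (P k $ 1 $ 2) *\<^sub>R v k \<in> span (C \<inter> common_kernel l (S \<union> T))" if "k < n" for k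
    using in_kernel[OF that] v_in_C[OF that]
    by (cases "Re (P k $ 1 $ 2) = 0") (auto intro!: span_scale intro: span_base span_zero)
  ultimately show "b \<in> span (C \<inter> common_kernel l (S \<union> T))"
    by (auto intro!: span_sum)
qed

section \<open>Facets\<close>

lemma minimal_finite_subset:
  assumes "finite X" "Q X"
  obtains Y where "Y \<subseteq> X" "Q Y" "\<And>y. y \<in> Y \<Longrightarrow> \<not> Q (Y - {y})"
proof -
  have "\<exists>Y\<subseteq>X. Q Y \<and> (\<forall>y\<in>Y. \<not> Q (Y - {y}))"
    using assms
  proof (induction X rule: finite_psubset_induct)
    case (psubset X)
    show ?case
    proof (cases "\<forall>y\<in>X. \<not> Q (X - {y})")
      case True
      with psubset.prems show ?thesis by blast
    next
      case False
      then obtain y where "y \<in> X" "Q (X - {y})" by blast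
      then show ?thesis
        using psubset.IH[of "X - {y}"] by blast
    qed
  qed
  with that show thesis by blast
qed

text \<open>The given functionals may be redundant, and a redundant one need not define a facet. The
  functionals of an irredundant subfamily do: dropping one of them admits a point \<open>x\<close> on its
  negative side, and the segment from \<open>x\<close> to an interior point of \<open>C\<close> crosses its hyperplane at
  a point where all other functionals are positive. Around that point, \<open>C\<close> contains a
  neighbourhood within the hyperplane. The common kernel is trivial because \<open>C\<close> contains no
  line.\<close>
lemma facet_functionals:
  fixes l :: "nat \<Rightarrow> real^'d \<Rightarrow> real"
  assumes lin: "\<And>i. i < m \<Longrightarrow> linear (l i)"
    and hs: "C = halfspace_cone m l"
    and "proper_cone C"
  obtains J where "J \<subseteq> {..<m}" "common_kernel l J = {0}"
    "\<And>j. j \<in> J \<Longrightarrow> common_kernel l {j} \<subseteq> span (C \<inter> common_kernel l {j})"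
proof -
  obtain J where J: "J \<subseteq> {..<m}" "C = {x. \<forall>i\<in>J. 0 \<le> l i x}"
    "\<And>j. j \<in> J \<Longrightarrow> C \<noteq> {x. \<forall>i\<in>J - {j}. 0 \<le> l i x}"
  proof (rule minimal_finite_subset[of "{..<m}" "\<lambda>J. C = {x. \<forall>i\<in>J. 0 \<le> l i x}"])
    show "C = {x. \<forall>i\<in>{..<m}. 0 \<le> l i x}"
      by (auto simp: hs halfspace_cone_def)
  qed (use that in auto)
  have linJ: "linear (l i)" if "i \<in> J" for i
    using that J(1) lin by auto
  have pointed: "C \<inter> uminus ` C = {0}"
    using \<open>proper_cone C\<close> by (simp add: proper_cone_def)
  have "common_kernel l J = {0}"
  proof
    show "common_kernel l J \<subseteq> {0}"
    proof
      fix x assume "x \<in> common_kernel l J"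
      then have "x \<in> C" "- x \<in> C"
        using linJ by (auto simp: J(2) common_kernel_def linear_neg)
      then have "x \<in> C \<inter> uminus ` C"
        by (auto intro!: image_eqI[of _ _ "- x"])
      then show "x \<in> {0}" using pointed by simp
    qed
    show "{0} \<subseteq> common_kernel l J"
      using linJ by (auto simp: common_kernel_def linear_0)
  qed
  moreover have "common_kernel l {j} \<subseteq> span (C \<inter> common_kernel l {j})" if j: "j \<in> J" for j
  proof
    fix z assume z: "z \<in> common_kernel l {j}"
    obtain p e where p: "0 < e" "ball p e \<subseteq> C"
      using \<open>proper_cone C\<close> unfolding proper_cone_def by (meson all_not_in_conv mem_interior)
    \<comment> \<open>A functional that is zero at an interior point but nonnegative around it is zero everywhere,
      hence redundant.\<close>
    have p_pos: "0 < l i p" if i: "i \<in> J" for i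
    proof (rule ccontr)
      assume "\<not> 0 < l i p"
      have "0 \<le> l i x" for x
      proof -
        define s where "s = e / 2 / (norm x + 1)"
        have pos: "0 < norm x + 1"
          by (simp add: add_nonneg_pos)
        then have s: "0 < s"
          using p(1) by (simp add: s_def)
        have "s * norm x \<le> s * (norm x + 1)"
          using s by simp
        also have "\<dots> = e / 2"
          unfolding s_def using pos by (metis less_irrefl nonzero_eq_divide_eq)
        finally have "s * norm x < e"
          using p(1) by simp
        with s have "p + s *\<^sub>R x \<in> ball p e"
          by (simp add: dist_norm)
        then have "0 \<le> l i (p + s *\<^sub>R x)"
          using p(2) i J(2) by blast
        then have "0 \<le> s * l i x"
          using \<open>\<not> 0 < l i p\<close> by (simp add: linear_add[OF linJ[OF i]] linear_cmul[OF linJ[OF i]])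
        then show ?thesis
          using s by (simp add: zero_le_mult_iff)
      qed
      then have "C = {x. \<forall>k\<in>J - {i}. 0 \<le> l k x}"
        using J(2) by auto
      then show False using J(3)[OF i] by simp
    qed
    have "\<not> {x. \<forall>i\<in>J - {j}. 0 \<le> l i x} \<subseteq> {x. \<forall>i\<in>J. 0 \<le> l i x}"
      using J(3)[OF j] unfolding J(2) by blast
    then obtain x where x: "\<And>i. i \<in> J - {j} \<Longrightarrow> 0 \<le> l i x" and "\<not> (\<forall>i\<in>J. 0 \<le> l i x)"
      by blast
    then have x_neg: "l j x < 0"
      by (metis DiffI not_le singletonD)
    \<comment> \<open>A positive multiple of the point where the segment from \<open>x\<close> to \<open>p\<close> crosses the
      hyperplane.\<close>
    define y where "y = l j p *\<^sub>R x - l j x *\<^sub>R p"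
    have l_y: "l i y = l j p * l i x - l j x * l i p" if "i \<in> J" for i
      by (simp add: y_def linear_diff[OF linJ[OF that]] linear_cmul[OF linJ[OF that]])
    have y_zero: "l j y = 0"
      by (simp add: l_y[OF j])
    have y_pos: "0 < l i y" if "i \<in> J - {j}" for i
    proof -
      have "0 \<le> l j p * l i x"
        using p_pos[OF j] x[OF that] by simp
      moreover have "l j x * l i p < 0"
        using p_pos x_neg that by (simp add: mult_neg_pos)
      ultimately show ?thesis
        using that by (simp add: l_y)
    qed
    have "finite (J - {j})"
      using J(1) finite_subset by blast
    then obtain N where N: "1 \<le> N" "\<And>i. i \<in> J - {j} \<Longrightarrow> \<bar>l i z\<bar> \<le> N * l i y"
      using dominating_multiplier[of "J - {j}" "\<lambda>i. l i y" "\<lambda>i. l i z"] y_pos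
      by (metis less_eq_real_def less_irrefl)
    have "0 \<le> l i (N *\<^sub>R y + z)" if "i \<in> J" for i
    proof (cases "i = j")
      case True
      with z y_zero j show ?thesis
        by (simp add: linear_add[OF linJ] linear_cmul[OF linJ] common_kernel_def)
    next
      case False
      with that N(2)[of i] show ?thesis
        by (simp add: linear_add[OF linJ] linear_cmul[OF linJ])
    qed
    then have 1: "N *\<^sub>R y + z \<in> C \<inter> common_kernel l {j}"
      using z y_zero j by (auto simp: J(2) common_kernel_def linear_add[OF linJ] linear_cmul[OF linJ])
    have "0 \<le> l i y" if "i \<in> J" for i
      using y_pos[of i] y_zero that by (cases "i = j") auto
    then have 2: "y \<in> C \<inter> common_kernel l {j}"
      using y_zero by (auto simp: J(2) common_kernel_def)
    have "z = (N *\<^sub>R y + z) - N *\<^sub>R y" by simp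
    then show "z \<in> span (C \<inter> common_kernel l {j})"
      using 1 2 by (metis span_base span_diff span_scale)
  qed
  ultimately show thesis
    using that J(1) by blast
qed

text \<open>A minimal set \<open>B\<close> of functionals with trivial common kernel is a basis of the dual space.
  By the spanning property, the dual basis vectors \<open>u\<close> can be found inside \<open>C\<close>; and \<open>C\<close> lies in
  the cone that they generate because the coordinate functionals with respect to \<open>u\<close> are among
  the \<open>l i\<close>.\<close>
lemma simplex_cone_if_facets_span:
  fixes l :: "nat \<Rightarrow> real^'d \<Rightarrow> real"
  assumes lin: "\<And>i. i < m \<Longrightarrow> linear (l i)"
    and hs: "C = halfspace_cone m l"
    and proper: "proper_cone C"
    and J: "J \<subseteq> {..<m}" "common_kernel l J = {0}"
    and faces: "\<And>S. S \<subseteq> J \<Longrightarrow> common_kernel l S \<subseteq> span (C \<inter> common_kernel l S)"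
  shows "simplex_cone C"
proof -
  obtain B where B: "B \<subseteq> J" "common_kernel l B = {0}"
    "\<And>j. j \<in> B \<Longrightarrow> common_kernel l (B - {j}) \<noteq> {0}"
    using minimal_finite_subset[of J "\<lambda>B. common_kernel l B = {0}"] J
    by (metis finite_lessThan finite_subset)
  have "finite B"
    using B(1) J(1) by (meson finite_lessThan finite_subset)
  have linB: "linear (l i)" if "i \<in> B" for i
    using that J(1) B(1) lin by auto
  have "\<exists>u\<in>C \<inter> common_kernel l (B - {j}). l j u = 1" if j: "j \<in> B" for j
  proof -
    have "0 \<in> common_kernel l (B - {j})"
      using linB by (auto simp: common_kernel_def linear_0)
    \<comment> \<open>If \<open>l j\<close> were zero on the part of \<open>C\<close> in this kernel, it would be zero on its span, and
      so at \<open>x\<close>, which contradicts the choice of \<open>B\<close>.\<close>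
    then obtain x where x: "x \<in> common_kernel l (B - {j})" "x \<noteq> 0"
      using B(3)[OF j] by blast
    have "l j x \<noteq> 0"
      using x B(2) j by (auto simp: common_kernel_def)
    moreover have "x \<in> span (C \<inter> common_kernel l (B - {j}))"
      using faces[of "B - {j}"] B(1) x(1) by blast
    ultimately obtain y where y: "y \<in> C \<inter> common_kernel l (B - {j})" "l j y \<noteq> 0"
      using linear_eq_0_on_span[OF linB[OF j]] by blast
    then have "0 < l j y"
      using j B(1) J(1) by (auto simp: hs halfspace_cone_def less_le)
    then have "(1 / l j y) *\<^sub>R y \<in> C \<inter> common_kernel l (B - {j})"
      using y(1) lin linB by (auto simp: hs halfspace_cone_def common_kernel_def linear_cmul)
    moreover have "l j ((1 / l j y) *\<^sub>R y) = 1"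
      using y(2) by (simp add: linear_cmul[OF linB[OF j]])
    ultimately show ?thesis by blast
  qed
  then obtain u where u: "\<And>j. j \<in> B \<Longrightarrow> u j \<in> C"
    "\<And>j. j \<in> B \<Longrightarrow> u j \<in> common_kernel l (B - {j})" "\<And>j. j \<in> B \<Longrightarrow> l j (u j) = 1"
    by (metis IntD1 IntD2)
  have coord: "l k (\<Sum>j\<in>B. c j *\<^sub>R u j) = c k" if k: "k \<in> B" for k c
  proof -
    have "l k (\<Sum>j\<in>B. c j *\<^sub>R u j) = (\<Sum>j\<in>B. c j * l k (u j))"
      by (simp add: linear_sum[OF linB[OF k]] linear_cmul[OF linB[OF k]])
    also have "\<dots> = (\<Sum>j\<in>B. if j = k then c j else 0)"
      using u(2,3) k by (intro sum.cong) (auto simp: common_kernel_def)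
    finally show ?thesis
      using k \<open>finite B\<close> by simp
  qed
  have expand: "x = (\<Sum>j\<in>B. l j x *\<^sub>R u j)" for x
  proof -
    have "x - (\<Sum>j\<in>B. l j x *\<^sub>R u j) \<in> common_kernel l B"
      by (auto simp: common_kernel_def linear_diff[OF linB] coord)
    then show ?thesis using B(2) by simp
  qed
  have inj: "inj_on u B"
  proof (rule inj_onI, rule ccontr)
    fix i j assume "i \<in> B" "j \<in> B" "u i = u j" "i \<noteq> j"
    then show False
      using u(2)[of j] u(3)[of i] by (simp add: common_kernel_def)
  qed
  have ind: "independent (u ` B)"
  proof (rule independent_if_scalars_zero)
    fix f x assume "(\<Sum>x\<in>u ` B. f x *\<^sub>R x) = 0" "x \<in> u ` B"
    then obtain j where j: "j \<in> B" "x = u j" and "(\<Sum>j\<in>B. f (u j) *\<^sub>R u j) = 0"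
      by (auto simp: sum.reindex[OF inj])
    then show "f x = 0"
      using coord[OF j(1), of "\<lambda>j. f (u j)"] by (simp add: linear_0[OF linB])
  qed (use \<open>finite B\<close> in simp)
  have "span (u ` B) = UNIV"
  proof (intro equalityI subset_UNIV subsetI)
    show "x \<in> span (u ` B)" for x
      by (subst expand) (auto intro!: span_sum span_scale intro: span_base)
  qed
  then have card: "card B = CARD('d)"
    using dim_eq_card[of "u ` B" UNIV] ind by (simp add: card_image[OF inj])
  obtain h where h: "bij_betw h {..<CARD('d)} B"
    using ex_bij_betw_nat_finite[OF \<open>finite B\<close>] by (auto simp: card atLeast0LessThan)
  have reindex: "(\<Sum>j\<in>B. g j) = (\<Sum>k<CARD('d). g (h k))" for g :: "nat \<Rightarrow> real^'d"
    by (rule sum.reindex_bij_betw[OF h, symmetric])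
  have hB: "h k \<in> B" if "k < CARD('d)" for k
    using h that by (auto simp: bij_betw_def)
  have "C = generated_cone CARD('d) (u \<circ> h)"
  proof
    show "C \<subseteq> generated_cone CARD('d) (u \<circ> h)"
    proof
      fix x assume "x \<in> C"
      then have nonneg: "0 \<le> l (h k) x" if "k < CARD('d)" for k
        using hB[OF that] B(1) J(1) by (auto simp: hs halfspace_cone_def)
      have sum: "x = (\<Sum>k<CARD('d). l (h k) x *\<^sub>R (u \<circ> h) k)"
        unfolding o_apply by (rule trans[OF expand reindex])
      show "x \<in> generated_cone CARD('d) (u \<circ> h)"
        unfolding generated_cone_def
        by (intro CollectI exI[of _ "\<lambda>k. l (h k) x"] conjI allI impI sum nonneg)
    qed
    show "generated_cone CARD('d) (u \<circ> h) \<subseteq> C"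
    proof
      fix x assume "x \<in> generated_cone CARD('d) (u \<circ> h)"
      then obtain c where c: "x = (\<Sum>k<CARD('d). c k *\<^sub>R u (h k))" "\<And>k. k < CARD('d) \<Longrightarrow> 0 \<le> c k"
        by (auto simp: generated_cone_def)
      have "0 \<le> l i (u (h k))" if "i < m" "k < CARD('d)" for i k
        using u(1)[OF hB[OF that(2)]] that(1) by (simp add: hs halfspace_cone_def)
      then show "x \<in> C"
        using c by (auto simp: hs halfspace_cone_def linear_sum[OF lin] linear_cmul[OF lin]
            intro!: sum_nonneg)
    qed
  qed
  moreover have "inj_on (u \<circ> h) {..<CARD('d)}" "independent ((u \<circ> h) ` {..<CARD('d)})"
    using h inj ind by (auto simp: bij_betw_def image_image intro: comp_inj_on)
  ultimately show ?thesis
    using proper unfolding simplex_cone_def by blast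
qed

text \<open>The spanning property of single facets passes to all intersections of facets by induction,
  with \<open>span_face_Int\<close> as the step. The empty intersection is \<open>C\<close> itself, which spans
  the space as it has an interior point.\<close>
lemma simplex_cone_if_C_ph_subset_C_pt:
  fixes l :: "nat \<Rightarrow> real^'d \<Rightarrow> real"
  assumes lin: "\<And>i. i < m \<Longrightarrow> linear (l i)"
    and hs: "C = halfspace_cone m l"
    and gen: "C = generated_cone n v"
    and proper: "proper_cone C"
    and eq: "(C_ph m l :: (complex^2^2^'d) set) \<subseteq> C_pt n v"
  shows "simplex_cone C"
proof -
  obtain J where J: "J \<subseteq> {..<m}" "common_kernel l J = {0}"
    "\<And>j. j \<in> J \<Longrightarrow> common_kernel l {j} \<subseteq> span (C \<inter> common_kernel l {j})"
    using facet_functionals[where l = l and m = m, OF lin hs proper] by blast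
  have "common_kernel l S \<subseteq> span (C \<inter> common_kernel l S)" if "S \<subseteq> J" for S
  proof -
    have "finite S"
      using that J(1) by (meson finite_lessThan finite_subset)
    then show ?thesis
      using that
    proof (induction S)
      case empty
      obtain p where "p \<in> interior C"
        using proper unfolding proper_cone_def by blast
      then have "\<not> dim C < DIM(real^'d)"
        using empty_interior_lowdim by blast
      then have "dim C = DIM(real^'d)"
        using dim_subset_UNIV[of C] by (simp add: not_less)
      then have "span C = UNIV"
        by (simp only: dim_eq_full)
      then show ?case
        by (simp add: common_kernel_def)
    next
      case (insert j S)
      have "common_kernel l ({j} \<union> S) \<subseteq> span (C \<inter> common_kernel l ({j} \<union> S))"
        using insert J by (intro span_face_Int[where l = l and m = m, OF lin hs gen eq]) auto
      then show ?case by simp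
    qed
  qed
  then show ?thesis
    using simplex_cone_if_facets_span[where l = l and m = m, OF lin hs proper J(1,2)] by blast
qed

section \<open>Minimal and maximal systems over a polyhedral cone\<close>

theorem theorem1:
  fixes C :: "(real^'d) set"
    and l :: "nat \<Rightarrow> real^'d \<Rightarrow> real" and m :: nat
    and v :: "nat \<Rightarrow> real^'d" and n :: nat
  assumes "proper_cone C"
    and "\<And>i. i < m \<Longrightarrow> linear (l i)"
    and "C = halfspace_cone m l"
    and "C = generated_cone n v"
  shows "(simplex_cone C \<longrightarrow> (C_pt n v :: (complex^'s^'s^'d) set) = C_ph m l) \<and>
         (\<not> simplex_cone C \<longrightarrow> (C_pt n v :: (complex^2^2^'d) set) \<subset> C_ph m l)"
proof (intro conjI impI)
  have hg: "halfspace_cone m l = generated_cone n v"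
    using assms(3,4) by simp
  show "(C_pt n v :: (complex^'s^'s^'d) set) = C_ph m l" if "simplex_cone C"
    using C_pt_subset_C_ph[where l = l and m = m, OF assms(2) hg] C_ph_subset_C_pt_if_simplex_cone[where l = l and m = m, OF assms(2-4) that]
    by (rule subset_antisym)
  show "(C_pt n v :: (complex^2^2^'d) set) \<subset> C_ph m l" if "\<not> simplex_cone C"
    using C_pt_subset_C_ph[where l = l and m = m, OF assms(2) hg]
      simplex_cone_if_C_ph_subset_C_pt[where l = l and m = m, OF assms(2-4) assms(1)] that
    by blast
qed

end
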